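(* Let $E=E(\tau,S)$ be an equation of state satisfying the standing assumptions listed in the context, and let $$R(\rho,S)=\int_1^{\rho}\frac{\sqrt{\hat p_\rho(r,S)}}{r}\,dr ,\qquad R(0+,S)=\lim_{\rho\to0^+}R(\rho,S)\in[-\infty,0).$$ Then the vacuum state exists in the solution of Riemann problems for the Euler equations (that is, there exist Riemann data $(\rho_l,u_l,S_l)$, $(\rho_r,u_r,S_r)$ with $\rho_l,\rho_r>0$ having a Riemann solution that contains a vacuum) if and only if there is some $S\in\mathbb{R}$ such that $$R(0+,S)>-\infty .$$
   Context: **Equations.** The Euler equations in one space dimension are $$\rho_t+(\rho u)_x=0,\qquad (\rho u)_t+(\rho u^2+p)_x=0,\qquad (\tfrac12\rho u^2+\rho E)_t+(u(\tfrac12\rho u^2+\rho E+p))_x=0,$$ with density $\rho$, specific volume $\tau=1/\rho$, velocity $u$, specific entropy $S$, specific internal energy $E=E(\tau,S)$, pressure $p=-E_\tau$ and temperature $T=E_S$. Write $\hat p(\rho,S)=p(1/\rho,S)$; the sound speed is $c=\sqrt{\hat p_\rho}$. **Standing assumptions on the equation of state.** $E\in C^2$ for $\tau\in(0,\infty)$, $S\in\mathbb{R}$; $p=-E_\tau>0$; $T=E_S\ge0$; $\lim_{\tau\to\infty}E(\tau,S)=0$ for each $S$, so $E>0$; $E_{\tau\tau}=-p_\tau>0$ and $E_{SS}\ge0$; the energy condition $\int_1^\infty p(\tau,S)\,d\tau<\infty$ for every $S$, with $E(\tau,S)=\int_\tau^\infty p(\tau',S)\,d\tau'$; and the forward and backward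 characteristic fields (speeds $u\pm c$) are genuinely nonlinear, i.e. $\tau\mapsto p(\tau,S)$ is strictly convex with $\sqrt{-p_\tau}=\rho c$ strictly increasing in $\rho$ for each $S$. **Elementary waves.** States are $(\rho,u,S)$. For a jump, $[g]=g_{\rm right}-g_{\rm left}$ and $\overline g$ is the average of the left and right values. The state ahead of a backward wave is its left state, and the state ahead of a forward wave is its right state; the other state is the behind state. - Backward rarefaction with left (ahead) state $(\rho_l,u_l,S_l)$: states $(\rho,u,S)$ with $S=S_l$, $\rho<\rho_l$, $u-u_l=R(\rho_l,S_l)-R(\rho,S_l)$. - Forward rarefaction with right (ahead) state $(\rho_r,u_r,S_r)$: states with $S=S_r$, $\rho<\rho_r$, $u_r-u=R(\rho_r,S_r)-R(\rho,S_r)$. - Backward or forward shock: $[E]+\overline p\,[\tau]=0$, $[u]=-\sqrt{-[p][\tau]}$, with pressure and density strictly larger behind than ahead. - Contact discontinuity: $[u]=0$, $[p]=0$. **Riemann problem.** The Riemann problem is the Cauchy problem with data equal to a constant state $(\rho_l,u_l,S_l)$ for $x<0$ and a constant state $(\rho_r,u_r,S_r)$ for $x>0$, with $\rho_l,\rho_r>0$. A Riemann solution without vacuum consists of two intermediate states $U_1,U_2$ of positive density such that $U_l,U_1$ are joined by a backward shock or rarefaction (or are equal), $U_1,U_2$ by a contact (or are equal), and $U_2,U_r$ by a forward shock or rarefaction (or are equal). A Riemann solution containing a vacuum consists of a backward rarefaction with left state $U_l$ along which $\rho$ decreases to $0$, and a forward rarefaction with right state $U_r$ along which (from right to left) $\rho$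 decreases to $0$, separated by a vacuum region $\rho=0$; the velocity is required to be finite and nondecreasing in $x$, so that the limiting velocities $u_l^*$, $u_r^*$ of the two rarefactions as $\rho\to0$ are finite and satisfy $u_l\le u_l^*\le u_r^*\le u_r$. *)

theory Defs
  imports "HOL-Analysis.Analysis"
begin

section \<open>Equations of state\<close>

text \<open>A function of specific volume and entropy is curried, \<open>E \<tau> S\<close>; it is only meaningful for
  \<open>\<tau> > 0\<close>, and values at other arguments are never used.\<close>

abbreviation partial1 :: "(real \<Rightarrow> real \<Rightarrow> real) \<Rightarrow> real \<Rightarrow> real \<Rightarrow> real"
  where "partial1 f \<equiv> (\<lambda>x y. deriv (\<lambda>x'. f x' y) x)"

abbreviation partial2 :: "(real \<Rightarrow> real \<Rightarrow> real) \<Rightarrow> real \<Rightarrow> real \<Rightarrow> real"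
  where "partial2 f \<equiv> (\<lambda>x y. deriv (\<lambda>y'. f x y') y)"

text \<open>Intended for open \<open>\<Omega>\<close>, where existence and continuity of the partial derivatives amounts
  to continuous differentiability.\<close>

definition C1_on :: "(real \<times> real) set \<Rightarrow> (real \<Rightarrow> real \<Rightarrow> real) \<Rightarrow> bool" where
  "C1_on \<Omega> f \<longleftrightarrow>
     (\<forall>(x, y) \<in> \<Omega>. (\<lambda>x'. f x' y) differentiable at x \<and> (\<lambda>y'. f x y') differentiable at y) \<and>
     continuous_on \<Omega> (\<lambda>(x, y). partial1 f x y) \<and>
     continuous_on \<Omega> (\<lambda>(x, y). partial2 f x y)"

definition C2_on :: "(real \<times> real) set \<Rightarrow> (real \<Rightarrow> real \<Rightarrow> real) \<Rightarrow> bool" where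
  "C2_on \<Omega> f \<longleftrightarrow> C1_on \<Omega> f \<and> C1_on \<Omega> (partial1 f) \<and> C1_on \<Omega> (partial2 f)"

definition strictly_convex_on :: "real set \<Rightarrow> (real \<Rightarrow> real) \<Rightarrow> bool" where
  "strictly_convex_on I f \<longleftrightarrow> convex I \<and>
     (\<forall>x\<in>I. \<forall>y\<in>I. \<forall>t. x \<noteq> y \<and> 0 < t \<and> t < 1 \<longrightarrow>
        f ((1 - t) * x + t * y) < (1 - t) * f x + t * f y)"

definition pressure :: "(real \<Rightarrow> real \<Rightarrow> real) \<Rightarrow> real \<Rightarrow> real \<Rightarrow> real" where
  "pressure E \<tau> S = - partial1 E \<tau> S"

definition temperature :: "(real \<Rightarrow> real \<Rightarrow> real) \<Rightarrow> real \<Rightarrow> real \<Rightarrow> real" where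
  "temperature E \<tau> S = partial2 E \<tau> S"

definition pressure_dens :: "(real \<Rightarrow> real \<Rightarrow> real) \<Rightarrow> real \<Rightarrow> real \<Rightarrow> real" where
  "pressure_dens E \<rho> S = pressure E (1 / \<rho>) S"

definition sound_speed :: "(real \<Rightarrow> real \<Rightarrow> real) \<Rightarrow> real \<Rightarrow> real \<Rightarrow> real" where
  "sound_speed E \<rho> S = sqrt (partial1 (pressure_dens E) \<rho> S)"

text \<open>Positivity of \<open>E\<close> and the integral formula for \<open>E\<close> follow from the other assumptions.
  In \<open>rho_c_increasing\<close>, \<open>sqrt (- p\<^sub>\<tau>)\<close> at \<open>\<tau> = 1 / \<rho>\<close> equals \<open>\<rho> * sound_speed E \<rho> S\<close>, since
  \<open>\<partial>/\<partial>\<rho> p(1/\<rho>, S) = - p\<^sub>\<tau> / \<rho>\<^sup>2\<close>.\<close>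

locale equation_of_state =
  fixes E :: "real \<Rightarrow> real \<Rightarrow> real"
  assumes C2: "C2_on ({0<..} \<times> UNIV) E"
    and pressure_pos: "\<And>\<tau> S. \<tau> > 0 \<Longrightarrow> pressure E \<tau> S > 0"
    and temperature_nonneg: "\<And>\<tau> S. \<tau> > 0 \<Longrightarrow> temperature E \<tau> S \<ge> 0"
    and energy_limit: "\<And>S. ((\<lambda>\<tau>. E \<tau> S) \<longlongrightarrow> 0) at_top"
    and energy_pos: "\<And>\<tau> S. \<tau> > 0 \<Longrightarrow> E \<tau> S > 0"
    and E_tau_tau_pos: "\<And>\<tau> S. \<tau> > 0 \<Longrightarrow> partial1 (partial1 E) \<tau> S > 0"
    and E_S_S_nonneg: "\<And>\<tau> S. \<tau> > 0 \<Longrightarrow> partial2 (partial2 E) \<tau> S \<ge> 0"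
    and energy_condition: "\<And>S. (\<lambda>\<tau>. pressure E \<tau> S) integrable_on {1..}"
    and energy_integral: "\<And>\<tau> S. \<tau> > 0 \<Longrightarrow> ((\<lambda>\<tau>'. pressure E \<tau>' S) has_integral E \<tau> S) {\<tau>..}"
    and pressure_convex: "\<And>S. strictly_convex_on {0<..} (\<lambda>\<tau>. pressure E \<tau> S)"
    and rho_c_increasing:
      "\<And>S. strict_mono_on {0<..} (\<lambda>\<rho>. sqrt (- partial1 (pressure E) (1 / \<rho>) S))"

section \<open>Rarefactions and vacuum\<close>

text \<open>The integral is oriented, so \<open>wave_R E \<rho> S \<le> 0\<close> for \<open>\<rho> \<le> 1\<close>.\<close>

definition wave_R :: "(real \<Rightarrow> real \<Rightarrow> real) \<Rightarrow> real \<Rightarrow> real \<Rightarrow> real" where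
  "wave_R E \<rho> S = (LBINT r=1..\<rho>. sound_speed E r S / r)"

text \<open>The limit is taken in the extended reals. It exists because \<open>wave_R\<close> is increasing in the
  density.\<close>

definition wave_R_zero :: "(real \<Rightarrow> real \<Rightarrow> real) \<Rightarrow> real \<Rightarrow> ereal" where
  "wave_R_zero E S = Lim (at_right 0) (\<lambda>\<rho>. ereal (wave_R E \<rho> S))"

text \<open>States are triples of density, velocity and entropy.\<close>

type_synonym state = "real \<times> real \<times> real"

definition backward_rarefaction :: "(real \<Rightarrow> real \<Rightarrow> real) \<Rightarrow> state \<Rightarrow> state set" where
  "backward_rarefaction E = (\<lambda>(\<rho>\<^sub>l, u\<^sub>l, S\<^sub>l).
     {(\<rho>, u, S). S = S\<^sub>l \<and> 0 < \<rho> \<and> \<rho> < \<rho>\<^sub>l \<and> u - u\<^sub>l = wave_R E \<rho>\<^sub>l S\<^sub>l - wave_R E \<rho> S\<^sub>l})"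

definition forward_rarefaction :: "(real \<Rightarrow> real \<Rightarrow> real) \<Rightarrow> state \<Rightarrow> state set" where
  "forward_rarefaction E = (\<lambda>(\<rho>\<^sub>r, u\<^sub>r, S\<^sub>r).
     {(\<rho>, u, S). S = S\<^sub>r \<and> 0 < \<rho> \<and> \<rho> < \<rho>\<^sub>r \<and> u\<^sub>r - u = wave_R E \<rho>\<^sub>r S\<^sub>r - wave_R E \<rho> S\<^sub>r})"

text \<open>A Riemann solution containing a vacuum, with data \<open>(\<rho>\<^sub>l, u\<^sub>l, S\<^sub>l)\<close> and \<open>(\<rho>\<^sub>r, u\<^sub>r, S\<^sub>r)\<close>. The
  two rarefactions are parametrised by the density, which runs through all positive values below
  that of the state ahead: \<open>v \<rho>\<close> and \<open>w \<rho>\<close> are the velocities in the backward and the forward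
  one. From left to right in \<open>x\<close> the density decreases to \<open>0\<close> in the backward wave and, after the
  vacuum, increases from \<open>0\<close> in the forward wave. Hence a velocity that is nondecreasing in \<open>x\<close> is
  antimonotone in \<open>\<rho>\<close> in the former and monotone in the latter, and \<open>v\<^sub>l\<close>, \<open>v\<^sub>r\<close>, the (finite)
  limiting velocities at the two edges of the vacuum, satisfy the displayed inequalities.\<close>

definition vacuum_solution ::
  "(real \<Rightarrow> real \<Rightarrow> real) \<Rightarrow> state \<Rightarrow> state \<Rightarrow>
   (real \<Rightarrow> real) \<Rightarrow> (real \<Rightarrow> real) \<Rightarrow> real \<Rightarrow> real \<Rightarrow> bool" where
  "vacuum_solution E = (\<lambda>(\<rho>\<^sub>l, u\<^sub>l, S\<^sub>l) (\<rho>\<^sub>r, u\<^sub>r, S\<^sub>r) v w v\<^sub>l v\<^sub>r.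
     (\<forall>\<rho>\<in>{0<..<\<rho>\<^sub>l}. (\<rho>, v \<rho>, S\<^sub>l) \<in> backward_rarefaction E (\<rho>\<^sub>l, u\<^sub>l, S\<^sub>l)) \<and>
     (\<forall>\<rho>\<in>{0<..<\<rho>\<^sub>r}. (\<rho>, w \<rho>, S\<^sub>r) \<in> forward_rarefaction E (\<rho>\<^sub>r, u\<^sub>r, S\<^sub>r)) \<and>
     antimono_on {0<..<\<rho>\<^sub>l} v \<and> mono_on {0<..<\<rho>\<^sub>r} w \<and>
     (v \<longlongrightarrow> v\<^sub>l) (at_right 0) \<and> (w \<longlongrightarrow> v\<^sub>r) (at_right 0) \<and>
     u\<^sub>l \<le> v\<^sub>l \<and> v\<^sub>l \<le> v\<^sub>r \<and> v\<^sub>r \<le> u\<^sub>r)"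

definition has_vacuum_solution :: "(real \<Rightarrow> real \<Rightarrow> real) \<Rightarrow> state \<Rightarrow> state \<Rightarrow> bool" where
  "has_vacuum_solution E U\<^sub>l U\<^sub>r \<longleftrightarrow> (\<exists>v w v\<^sub>l v\<^sub>r. vacuum_solution E U\<^sub>l U\<^sub>r v w v\<^sub>l v\<^sub>r)"

end

theory Submission
  imports Defs
begin

text \<open>Along a rarefaction the velocity is a constant plus or minus R(\<rho>, S) at fixed
  entropy, so it has a finite limit as \<rho> tends to 0 exactly when R does. The backward wave of a
  vacuum solution therefore makes R(0+, S) finite at the left entropy
  (\<open>vacuum_solution_imp_wave_R_zero_finite\<close>). Conversely, if R(0+, S) is finite for
  some S, data with this entropy on both sides that move apart fast enough open a vacuum
  (\<open>vacuum_solution_of_wave_R_zero_finite\<close>). The converse also needs R to be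
  nondecreasing in \<rho>: its integrand c/\<rho> is nonnegative (\<open>wave_R_mono\<close>), so
  the limit at 0 exists (\<open>wave_R_tendsto_wave_R_zero\<close>) and velocities are ordered
  within each wave.\<close>

lemma C1_on_has_partial1:
  assumes "C1_on \<Omega> f" "(x, y) \<in> \<Omega>"
  shows "((\<lambda>x'. f x' y) has_field_derivative partial1 f x y) (at x)"
proof -
  have "(\<lambda>x'. f x' y) field_differentiable at x"
    using assms by (auto simp: C1_on_def field_differentiable_def real_differentiable_def)
  then show ?thesis
    by (simp add: DERIV_deriv_iff_field_differentiable)
qed

context equation_of_state
begin

text \<open>Chain rule for p = - E_\<tau> at \<tau> = 1/\<rho>. It expresses the squared sound speed
  through E_\<tau>\<tau>, whose positivity and continuity are assumed.\<close>

lemma partial1_pressure_dens: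
  assumes "\<rho> > 0"
  shows "partial1 (pressure_dens E) \<rho> S = partial1 (partial1 E) (1 / \<rho>) S / \<rho>\<^sup>2"
proof -
  have "((\<lambda>\<tau>. partial1 E \<tau> S) has_field_derivative partial1 (partial1 E) (1 / \<rho>) S) (at (1 / \<rho>))"
    using C2 assms by (intro C1_on_has_partial1[where \<Omega> = "{0<..} \<times> UNIV"]) (auto simp: C2_on_def)
  moreover have "((\<lambda>r. 1 / r) has_field_derivative - 1 / \<rho>\<^sup>2) (at \<rho>)"
    using assms by (auto intro!: derivative_eq_intros simp: power2_eq_square)
  ultimately have "((\<lambda>r. partial1 E (1 / r) S) has_field_derivative
      partial1 (partial1 E) (1 / \<rho>) S * (- 1 / \<rho>\<^sup>2)) (at \<rho>)"
    by (rule DERIV_chain2)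
  then have "((\<lambda>r. - partial1 E (1 / r) S) has_field_derivative
      partial1 (partial1 E) (1 / \<rho>) S / \<rho>\<^sup>2) (at \<rho>)"
    by (auto intro: derivative_eq_intros)
  then show ?thesis
    unfolding pressure_dens_def pressure_def by (rule DERIV_imp_deriv)
qed

lemma sound_speed_nonneg: "\<rho> > 0 \<Longrightarrow> sound_speed E \<rho> S \<ge> 0"
  by (simp add: sound_speed_def partial1_pressure_dens less_imp_le E_tau_tau_pos)

lemma continuous_on_sound_speed: "continuous_on {0<..} (\<lambda>\<rho>. sound_speed E \<rho> S)"
proof -
  have "continuous_on ({0<..} \<times> UNIV) (\<lambda>(\<tau>, S). partial1 (partial1 E) \<tau> S)"
    using C2 by (simp add: C2_on_def C1_on_def)
  moreover have "continuous_on {0<..} (\<lambda>\<rho>::real. (1 / \<rho>, S))"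
    by (intro continuous_intros) auto
  ultimately have
    "continuous_on {0<..} (\<lambda>\<rho>. (\<lambda>(\<tau>, S). partial1 (partial1 E) \<tau> S) (1 / \<rho>, S))"
    by (rule continuous_on_compose2) auto
  then have "continuous_on {0<..} (\<lambda>\<rho>. sqrt (partial1 (partial1 E) (1 / \<rho>) S / \<rho>\<^sup>2))"
    by (intro continuous_on_real_sqrt continuous_on_divide continuous_on_power continuous_on_id) auto
  then show ?thesis
    by (rule continuous_on_eq) (simp add: sound_speed_def partial1_pressure_dens)
qed

text \<open>The difference of the two values is the integral of the nonnegative function c/r over
  [a, b].\<close>

lemma wave_R_mono:
  assumes "0 < a" "a \<le> b"
  shows "wave_R E a S \<le> wave_R E b S"
proof -
  let ?f = "\<lambda>r. sound_speed E r S / r"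
  have cont: "continuous_on {0<..} ?f"
    by (intro continuous_intros continuous_on_sound_speed) auto
  \<comment> \<open>The points a and b may lie on either side of 1; additivity of the oriented
    integral requires integrability on the hull of all three points.\<close>
  have "interval_lebesgue_integrable lborel (ereal (min 1 a)) (ereal (max 1 b)) ?f"
    using assms
    by (intro interval_integrable_continuous_on continuous_on_subset[OF cont]) auto
  then have "(LBINT r=ereal 1..ereal a. ?f r) + (LBINT r=ereal a..ereal b. ?f r)
      = (LBINT r=ereal 1..ereal b. ?f r)"
    using assms by (intro interval_integral_sum) (auto simp: min_def max_def split: if_splits)
  then have "wave_R E b S = wave_R E a S + (LBINT r=ereal a..ereal b. ?f r)"
    by (simp add: wave_R_def one_ereal_def)
  moreover have "(LBINT r=ereal a..ereal b. ?f r) = (LBINT r:{a..b}. ?f r)"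
    using assms by (simp add: interval_integral_Icc)
  moreover have "(LBINT r:{a..b}. ?f r) \<ge> 0"
    unfolding set_lebesgue_integral_def using assms
    by (intro integral_nonneg_AE AE_I2) (auto simp: indicator_def sound_speed_nonneg)
  ultimately show ?thesis
    by simp
qed

text \<open>\<open>Lim\<close> only denotes a limit once one is known to exist. By monotonicity R
  converges at 0 to its infimum over positive densities, possibly -\<infinity>.\<close>

lemma wave_R_tendsto_wave_R_zero:
  "((\<lambda>\<rho>. ereal (wave_R E \<rho> S)) \<longlongrightarrow> wave_R_zero E S) (at_right 0)"
proof -
  have "((\<lambda>\<rho>. ereal (wave_R E \<rho> S)) \<longlongrightarrow> (INF \<rho>\<in>{0<..}. ereal (wave_R E \<rho> S))) (at_right 0)"
  proof (rule order_tendstoI)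
    fix y assume "y < (INF \<rho>\<in>{0<..}. ereal (wave_R E \<rho> S))"
    then show "\<forall>\<^sub>F \<rho> in at_right 0. y < ereal (wave_R E \<rho> S)"
      by (auto intro!: eventually_at_right_less[THEN eventually_mono] dest: less_INF_D)
  next
    fix y assume "(INF \<rho>\<in>{0<..}. ereal (wave_R E \<rho> S)) < y"
    then obtain r where r: "r > 0" "ereal (wave_R E r S) < y"
      by (auto simp: INF_less_iff)
    have "ereal (wave_R E \<rho> S) < y" if "0 < \<rho>" "\<rho> < r" for \<rho>
      using wave_R_mono[of \<rho> r S] that r(2) by (meson ereal_less_eq(3) le_less_trans less_imp_le)
    then show "\<forall>\<^sub>F \<rho> in at_right 0. ereal (wave_R E \<rho> S) < y"
      using r(1) by (auto simp: eventually_at_right_field)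
  qed
  then show ?thesis
    unfolding wave_R_zero_def by (simp add: tendsto_Lim)
qed

end

lemma wave_R_one: "wave_R E 1 S = 0"
  by (simp add: wave_R_def one_ereal_def)

lemma wave_R_zero_eqI:
  assumes "((\<lambda>\<rho>. wave_R E \<rho> S) \<longlongrightarrow> L) (at_right 0)"
  shows "wave_R_zero E S = ereal L"
  unfolding wave_R_zero_def using assms by (intro tendsto_Lim) auto

text \<open>The backward wave relation, solved for R, gives R as a constant minus the velocity near
  \<rho> = 0; the finite velocity at the vacuum edge then fixes the limit of R.\<close>

lemma vacuum_solution_imp_wave_R_zero_finite:
  assumes "vacuum_solution E (\<rho>\<^sub>l, u\<^sub>l, S\<^sub>l) U\<^sub>r v w v\<^sub>l v\<^sub>r" "\<rho>\<^sub>l > 0"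
  shows "wave_R_zero E S\<^sub>l = ereal (wave_R E \<rho>\<^sub>l S\<^sub>l - (v\<^sub>l - u\<^sub>l))"
proof (rule wave_R_zero_eqI)
  have v: "(v \<longlongrightarrow> v\<^sub>l) (at_right 0)"
    and wave: "\<And>\<rho>. 0 < \<rho> \<Longrightarrow> \<rho> < \<rho>\<^sub>l \<Longrightarrow> v \<rho> - u\<^sub>l = wave_R E \<rho>\<^sub>l S\<^sub>l - wave_R E \<rho> S\<^sub>l"
    using assms(1) by (cases U\<^sub>r; auto simp: vacuum_solution_def backward_rarefaction_def)+
  have "((\<lambda>\<rho>. wave_R E \<rho>\<^sub>l S\<^sub>l - (v \<rho> - u\<^sub>l)) \<longlongrightarrow> wave_R E \<rho>\<^sub>l S\<^sub>l - (v\<^sub>l - u\<^sub>l)) (at_right 0)"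
    by (intro tendsto_intros v)
  moreover have "\<forall>\<^sub>F \<rho> in at_right 0. wave_R E \<rho>\<^sub>l S\<^sub>l - (v \<rho> - u\<^sub>l) = wave_R E \<rho> S\<^sub>l"
    unfolding eventually_at_right_field
    using assms(2) by (intro exI[of _ "\<rho>\<^sub>l"]) (simp add: wave)
  ultimately show "((\<lambda>\<rho>. wave_R E \<rho> S\<^sub>l) \<longlongrightarrow> wave_R E \<rho>\<^sub>l S\<^sub>l - (v\<^sub>l - u\<^sub>l)) (at_right 0)"
    by (rule Lim_transform_eventually)
qed

text \<open>Two gases at unit density and equal entropy that separate with relative velocity
  \<open>- 2 R(0+, S)\<close>: the two rarefactions just reach \<open>\<rho> = 0\<close> with the same limiting velocity.\<close>

lemma (in equation_of_state) vacuum_solution_of_wave_R_zero_finite: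
  assumes "wave_R_zero E S > -\<infinity>"
  shows "\<exists>u\<^sub>r. has_vacuum_solution E (1, 0, S) (1, u\<^sub>r, S)"
proof -
  have neg: "wave_R E \<rho> S \<le> 0" if "0 < \<rho>" "\<rho> < 1" for \<rho>
    using wave_R_mono[of \<rho> 1 S] that by (simp add: wave_R_one)
  have "wave_R_zero E S \<le> 0"
    using wave_R_tendsto_wave_R_zero
  proof (rule tendsto_upperbound)
    show "\<forall>\<^sub>F \<rho> in at_right 0. ereal (wave_R E \<rho> S) \<le> 0"
      unfolding eventually_at_right_field by (intro exI[of _ 1]) (simp add: neg)
  qed simp
  \<comment> \<open>The bound by R(1, S) = 0 excludes +\<infinity>, so the limit is real; its sign
    is used again to order the velocities.\<close>
  with assms obtain L where L: "wave_R_zero E S = ereal L" "L \<le> 0"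
    by (cases "wave_R_zero E S") auto
  have lim: "((\<lambda>\<rho>. wave_R E \<rho> S) \<longlongrightarrow> L) (at_right 0)"
    using wave_R_tendsto_wave_R_zero[of S] by (simp add: L)
  have "((\<lambda>\<rho>. - wave_R E \<rho> S) \<longlongrightarrow> - L) (at_right 0)"
    by (intro tendsto_intros lim)
  moreover have "((\<lambda>\<rho>. - 2 * L + wave_R E \<rho> S) \<longlongrightarrow> - 2 * L + L) (at_right 0)"
    by (intro tendsto_intros lim)
  \<comment> \<open>Since R(1, S) = 0, the wave relations with u = 0 on the left and u = -2L on the
    right force the velocities -R and -2L + R. Both tend to -L, and L \<le> 0 yields 0 \<le> -L
    \<le> -2L.\<close>
  ultimately have "vacuum_solution E (1, 0, S) (1, - 2 * L, S)
      (\<lambda>\<rho>. - wave_R E \<rho> S) (\<lambda>\<rho>. - 2 * L + wave_R E \<rho> S) (- L) (- L)"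
    using L(2)
    by (auto simp: vacuum_solution_def backward_rarefaction_def forward_rarefaction_def
        wave_R_one monotone_on_def intro: wave_R_mono)
  then show ?thesis
    unfolding has_vacuum_solution_def by blast
qed

theorem lemma3p1:
  fixes E :: "real \<Rightarrow> real \<Rightarrow> real"
  assumes "equation_of_state E"
  shows "(\<exists>\<rho>\<^sub>l u\<^sub>l S\<^sub>l \<rho>\<^sub>r u\<^sub>r S\<^sub>r. \<rho>\<^sub>l > 0 \<and> \<rho>\<^sub>r > 0 \<and>
            has_vacuum_solution E (\<rho>\<^sub>l, u\<^sub>l, S\<^sub>l) (\<rho>\<^sub>r, u\<^sub>r, S\<^sub>r))
         \<longleftrightarrow> (\<exists>S. wave_R_zero E S > -\<infinity>)"
proof
  assume "\<exists>\<rho>\<^sub>l u\<^sub>l S\<^sub>l \<rho>\<^sub>r u\<^sub>r S\<^sub>r. \<rho>\<^sub>l > 0 \<and> \<rho>\<^sub>r > 0 \<and>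
    has_vacuum_solution E (\<rho>\<^sub>l, u\<^sub>l, S\<^sub>l) (\<rho>\<^sub>r, u\<^sub>r, S\<^sub>r)"
  then obtain \<rho>\<^sub>l u\<^sub>l S\<^sub>l U\<^sub>r v w v\<^sub>l v\<^sub>r
    where "\<rho>\<^sub>l > 0" "vacuum_solution E (\<rho>\<^sub>l, u\<^sub>l, S\<^sub>l) U\<^sub>r v w v\<^sub>l v\<^sub>r"
    unfolding has_vacuum_solution_def by blast
  then have "wave_R_zero E S\<^sub>l > -\<infinity>"
    by (simp add: vacuum_solution_imp_wave_R_zero_finite)
  then show "\<exists>S. wave_R_zero E S > -\<infinity>" ..
next
  interpret equation_of_state E by fact
  assume "\<exists>S. wave_R_zero E S > -\<infinity>"
  then show "\<exists>\<rho>\<^sub>l u\<^sub>l S\<^sub>l \<rho>\<^sub>r u\<^sub>r S\<^sub>r. \<rho>\<^sub>l > 0 \<and> \<rho>\<^sub>r > 0 \<and>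
    has_vacuum_solution E (\<rho>\<^sub>l, u\<^sub>l, S\<^sub>l) (\<rho>\<^sub>r, u\<^sub>r, S\<^sub>r)"
    using vacuum_solution_of_wave_R_zero_finite zero_less_one by blast
qed

end
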